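(* For all $n\in\mathbb P$, one has $$\mathbb Q\text{-span}\{\kappa^{\mathsf Q}_\alpha:\deg(\kappa^{\mathsf Q}_\alpha)=n\}\not\subseteq\mathbb Q\text{-span}\{\kappa^{\mathsf P}_\alpha:\deg(\kappa^{\mathsf P}_\alpha)=n\},$$ where $\alpha$ ranges over symmetric weak compositions.
   Context: Let $\mathbb P=\{1,2,3,\dots\}$. $S_\infty$ is the group of permutations of $\mathbb P$ generated by $s_i=(i\;\,i+1)$; it acts on $\mathbb Q[x_1,x_2,\dots]$ by permuting variables. Define $\pi_i f=(x_if-x_{i+1}s_if)/(x_i-x_{i+1})$; these satisfy the braid relations, so $\pi_w=\pi_{i_1}\cdots\pi_{i_l}$ is well-defined for any reduced word $i_1\cdots i_l$ of $w\in S_\infty$. A weak composition is a sequence $\alpha=(\alpha_1,\alpha_2,\dots)$ of nonnegative integers with finite sum. A partition is a weakly decreasing weak composition; it is strict if its nonzero parts are distinct. $S_\infty$ acts by $w\alpha=(\alpha_{w^{-1}(1)},\alpha_{w^{-1}(2)},\dots)$. Let $\lambda(\alpha)$ be the partition sorting $\alpha$ and $u(\alpha)$ the minimal-length $u\in S_\infty$ with $\alpha=u\lambda(\alpha)$. Let $\mathsf D_\mu=\{(i,j)\in\mathbb P\times\mathbb P:1\le j\le\mu_i\}$. For $w\in S_\infty$ and strict $\mu$: $\kappa^{\mathsf P}_{w,\mu}=\pi_w\prod_{(i,j)\in\mathsf D_\mu}(x_i+x_{i+j})$ and $\kappa^{\mathsf Q}_{w,\mu}=\pi_w\prod_{(i,j)\in\mathsf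 D_\mu}(x_i+x_{i+j-1})$. A partition $\lambda$ is symmetric if $\lambda=\lambda^{\mathsf T}$; a weak composition $\alpha$ is symmetric if $\lambda(\alpha)$ is. For a symmetric partition $\lambda$, $\mathrm{half}_<(\lambda)$ and $\mathrm{half}_\le(\lambda)$ are the strict partitions with nonzero parts $\{\lambda_i-i:i\in\mathbb P\}\cap\mathbb P$ and $\{\lambda_i-(i-1):i\in\mathbb P\}\cap\mathbb P$. For a symmetric weak composition $\alpha$: $\kappa^{\mathsf P}_\alpha=\kappa^{\mathsf P}_{u(\alpha),\mathrm{half}_<(\lambda(\alpha))}$ and $\kappa^{\mathsf Q}_\alpha=\kappa^{\mathsf Q}_{u(\alpha),\mathrm{half}_\le(\lambda(\alpha))}$. *)

theory Defs
  imports Complex_Main "HOL-Library.Poly_Mapping" "HOL-Combinatorics.Transposition"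
begin

text \<open>
  Indices are positive integers: \<open>0 :: nat\<close> is a dummy position, where weak compositions vanish
  and which all permutations in \<open>S_inf\<close> fix.
\<close>

subsection \<open>The group generated by the adjacent transpositions\<close>

definition adj :: "nat \<Rightarrow> nat \<Rightarrow> nat"
  where "adj i = transpose i (i + 1)"

definition word_perm :: "nat list \<Rightarrow> nat \<Rightarrow> nat"
  where "word_perm ws = foldr (\<lambda>i w. adj i \<circ> w) ws id"

text \<open>The generators are involutions, so the group they generate consists of the products of words.\<close>

definition S_inf :: "(nat \<Rightarrow> nat) set"
  where "S_inf = word_perm ` lists {1..}"

definition perm_length :: "(nat \<Rightarrow> nat) \<Rightarrow> nat"
  where "perm_length w = (LEAST l. \<exists>ws \<in> lists {1..}. word_perm ws = w \<and> length ws = l)"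

definition reduced_word :: "(nat \<Rightarrow> nat) \<Rightarrow> nat list \<Rightarrow> bool"
  where "reduced_word w ws \<longleftrightarrow> ws \<in> lists {1..} \<and> word_perm ws = w \<and> length ws = perm_length w"


subsection \<open>Weak compositions and partitions\<close>

definition weak_comp :: "(nat \<Rightarrow>\<^sub>0 nat) \<Rightarrow> bool"
  where "weak_comp \<alpha> \<longleftrightarrow> Poly_Mapping.lookup \<alpha> 0 = 0"

definition is_partition :: "(nat \<Rightarrow>\<^sub>0 nat) \<Rightarrow> bool"
  where "is_partition \<nu> \<longleftrightarrow> weak_comp \<nu> \<and>
    (\<forall>i \<ge> 1. Poly_Mapping.lookup \<nu> (i + 1) \<le> Poly_Mapping.lookup \<nu> i)"

definition is_strict :: "(nat \<Rightarrow>\<^sub>0 nat) \<Rightarrow> bool"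
  where "is_strict \<mu> \<longleftrightarrow> is_partition \<mu> \<and> inj_on (Poly_Mapping.lookup \<mu>) (Poly_Mapping.keys \<mu>)"

text \<open>\<open>map_key f m\<close> is \<open>m \<circ> f\<close> for injective \<open>f\<close>.\<close>

definition act :: "(nat \<Rightarrow> nat) \<Rightarrow> (nat \<Rightarrow>\<^sub>0 nat) \<Rightarrow> (nat \<Rightarrow>\<^sub>0 nat)"
  where "act w \<alpha> = Poly_Mapping.map_key (inv w) \<alpha>"

definition sort_comp :: "(nat \<Rightarrow>\<^sub>0 nat) \<Rightarrow> (nat \<Rightarrow>\<^sub>0 nat)"
  where "sort_comp \<alpha> = (THE \<nu>. is_partition \<nu> \<and> (\<exists>w \<in> S_inf. \<nu> = act w \<alpha>))"

definition min_perm :: "(nat \<Rightarrow>\<^sub>0 nat) \<Rightarrow> (nat \<Rightarrow> nat)"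
  where "min_perm \<alpha> = arg_min perm_length (\<lambda>u. u \<in> S_inf \<and> \<alpha> = act u (sort_comp \<alpha>))"

definition diagram :: "(nat \<Rightarrow>\<^sub>0 nat) \<Rightarrow> (nat \<times> nat) set"
  where "diagram \<mu> = {(i, j). 1 \<le> i \<and> 1 \<le> j \<and> j \<le> Poly_Mapping.lookup \<mu> i}"

lift_definition conjugate :: "(nat \<Rightarrow>\<^sub>0 nat) \<Rightarrow> (nat \<Rightarrow>\<^sub>0 nat)"
  is "\<lambda>l j. if j = 0 then 0 else card {i. 1 \<le> i \<and> j \<le> l i}"
proof -
  fix l :: "nat \<Rightarrow> nat"
  assume fin: "finite {k. l k \<noteq> 0}"
  have "{j. (if j = 0 then 0 else card {i. 1 \<le> i \<and> j \<le> l i}) \<noteq> 0}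
      \<subseteq> (\<Union>i \<in> {k. l k \<noteq> 0}. {..l i})"
  proof
    fix j assume "j \<in> {j. (if j = 0 then 0 else card {i. 1 \<le> i \<and> j \<le> l i}) \<noteq> 0}"
    then have "j \<noteq> 0" and c: "card {i. 1 \<le> i \<and> j \<le> l i} \<noteq> 0" by (simp_all split: if_splits)
    from c obtain i where "j \<le> l i" by (metis (mono_tags, lifting) card.empty empty_Collect_eq)
    with \<open>j \<noteq> 0\<close> show "j \<in> (\<Union>i \<in> {k. l k \<noteq> 0}. {..l i})"
      by (intro UN_I[of i]) simp_all
  qed
  then show "finite {j. (if j = 0 then 0 else card {i. 1 \<le> i \<and> j \<le> l i}) \<noteq> 0}"
    by (rule finite_subset) (intro finite_UN_I fin finite_atMost)
qed

definition symmetric_partition :: "(nat \<Rightarrow>\<^sub>0 nat) \<Rightarrow> bool"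
  where "symmetric_partition \<nu> \<longleftrightarrow> is_partition \<nu> \<and> conjugate \<nu> = \<nu>"

definition symmetric_comp :: "(nat \<Rightarrow>\<^sub>0 nat) \<Rightarrow> bool"
  where "symmetric_comp \<alpha> \<longleftrightarrow> weak_comp \<alpha> \<and> symmetric_partition (sort_comp \<alpha>)"

text \<open>
  Subtraction on \<open>nat\<close> truncates at \<open>0\<close>, but intersecting with \<open>{1..}\<close> discards all the values
  at which this happens.
\<close>

definition strict_with_parts :: "nat set \<Rightarrow> (nat \<Rightarrow>\<^sub>0 nat)"
  where "strict_with_parts A = (THE \<mu>. is_strict \<mu> \<and> Poly_Mapping.range \<mu> = A)"

definition half_less :: "(nat \<Rightarrow>\<^sub>0 nat) \<Rightarrow> (nat \<Rightarrow>\<^sub>0 nat)"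
  where "half_less \<nu> = strict_with_parts ({Poly_Mapping.lookup \<nu> i - i | i. 1 \<le> i} \<inter> {1..})"

definition half_le :: "(nat \<Rightarrow>\<^sub>0 nat) \<Rightarrow> (nat \<Rightarrow>\<^sub>0 nat)"
  where "half_le \<nu> = strict_with_parts ({Poly_Mapping.lookup \<nu> i - (i - 1) | i. 1 \<le> i} \<inter> {1..})"


subsection \<open>Polynomials and the operators\<close>

text \<open>A monomial is identified with its exponent vector.\<close>

type_synonym rpoly = "(nat \<Rightarrow>\<^sub>0 nat) \<Rightarrow>\<^sub>0 rat"

definition var :: "nat \<Rightarrow> rpoly"
  where "var i = Poly_Mapping.single (Poly_Mapping.single i 1) 1"

definition poly_scale :: "rat \<Rightarrow> rpoly \<Rightarrow> rpoly"
  where "poly_scale c f = Poly_Mapping.single 0 c * f"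

definition rat_span :: "rpoly set \<Rightarrow> rpoly set"
  where "rat_span = module.span poly_scale"

definition total_degree :: "rpoly \<Rightarrow> nat"
  where "total_degree f = Max (insert 0 ((\<lambda>m. \<Sum>i \<in> Poly_Mapping.keys m. Poly_Mapping.lookup m i) ` Poly_Mapping.keys f))"

text \<open>
  The ring automorphism \<open>var i \<mapsto> var (w i)\<close>: it moves the exponent vector \<open>m\<close> to \<open>act w m\<close>, so the
  coefficient of \<open>m\<close> in the result is that of \<open>act (inv w) m\<close>, i.e. of \<open>map_key w m\<close>, in \<open>f\<close>.
\<close>

definition perm_poly :: "(nat \<Rightarrow> nat) \<Rightarrow> rpoly \<Rightarrow> rpoly"
  where "perm_poly w f = Poly_Mapping.map_key (Poly_Mapping.map_key w) f"

text \<open>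
  The quotient exists, as \<open>f - perm_poly (adj i) f\<close> is divisible by \<open>var i - var (i + 1)\<close>, and is
  unique because polynomials form an integral domain.
\<close>

definition demazure :: "nat \<Rightarrow> rpoly \<Rightarrow> rpoly"
  where "demazure i f =
    (THE g. (var i - var (i + 1)) * g = var i * f - var (i + 1) * perm_poly (adj i) f)"

text \<open>By the braid relations the choice of the reduced word does not matter.\<close>

definition demazure_perm :: "(nat \<Rightarrow> nat) \<Rightarrow> rpoly \<Rightarrow> rpoly"
  where "demazure_perm w f = foldr demazure (SOME ws. reduced_word w ws) f"

definition kappaP_perm :: "(nat \<Rightarrow> nat) \<Rightarrow> (nat \<Rightarrow>\<^sub>0 nat) \<Rightarrow> rpoly"
  where "kappaP_perm w \<mu> = demazure_perm w (\<Prod>(i, j) \<in> diagram \<mu>. var i + var (i + j))"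

definition kappaQ_perm :: "(nat \<Rightarrow> nat) \<Rightarrow> (nat \<Rightarrow>\<^sub>0 nat) \<Rightarrow> rpoly"
  where "kappaQ_perm w \<mu> = demazure_perm w (\<Prod>(i, j) \<in> diagram \<mu>. var i + var (i + j - 1))"

definition kappaP :: "(nat \<Rightarrow>\<^sub>0 nat) \<Rightarrow> rpoly"
  where "kappaP \<alpha> = kappaP_perm (min_perm \<alpha>) (half_less (sort_comp \<alpha>))"

definition kappaQ :: "(nat \<Rightarrow>\<^sub>0 nat) \<Rightarrow> rpoly"
  where "kappaQ \<alpha> = kappaQ_perm (min_perm \<alpha>) (half_le (sort_comp \<alpha>))"

end

theory Submission
  imports Defs "HOL-Combinatorics.Permutations"
begin

text \<open>
  The key polynomials \<open>\<kappa>_\<beta> = \<pi>_u x^\<lambda>\<close>, one for each weak composition \<open>\<beta> = u \<lambda>\<close> with \<open>\<lambda>\<close> a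
  partition and \<open>u\<close> of minimal length, form a basis of the polynomial ring. The family Q is separated
  from the family P by the coefficient of one key polynomial, namely of \<open>x_1 \<dots> x_n\<close>, the one with
  \<open>\<beta> = (1^n)\<close>: this coefficient vanishes on all \<open>\<kappa>^P_\<alpha>\<close>, but it is \<open>2\<close> on the product
  \<open>\<Prod>k\<in>{1..n}. x_1 + x_k\<close>, which is \<open>\<kappa>^Q_\<alpha>\<close> for the hook \<open>\<alpha> = (n, 1^(n-1))\<close>.
  
  The theory of key polynomials is avoided by writing this coefficient as an explicit functional: with
  \<open>\<rho>_n = (n-1, \<dots>, 1, 0, 0, \<dots>)\<close>, it is the alternating sum of the coefficients of the rearrangements
  of \<open>\<rho>_(n+1)\<close> in \<open>x^(\<rho>_n) f\<close> (\<open>key_coeff\<close>). The isobaric divided difference \<open>\<pi>_n\<close> has symmetric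
  values and \<open>\<rho>_n\<close> is symmetric in the positions \<open>n\<close> and \<open>n+1\<close>, so the functional kills the image of
  \<open>\<pi>_n\<close>; a similar cancellation shows that every other \<open>\<pi>_i\<close> preserves it (\<open>key_coeff_demazure\<close>).
  It thus suffices to see that the functional vanishes on the product attached to a strict partition
  \<open>\<mu>\<close> in the family P (\<open>key_coeff_diagram_prod\<close>). For \<open>|\<mu>| \<noteq> n\<close> the degree is wrong.
  If \<open>\<mu>_1 \<le> n - 2\<close>, then neither \<open>x_n\<close> nor \<open>x_(n+1)\<close> occurs; if \<open>\<mu> = (n)\<close>, the product is
  symmetric in these two variables. What is left is \<open>\<mu> = (n-1, 1)\<close>, where the terms cancel or have
  exponents that are too large (\<open>key_coeff_row_prod_mult\<close>).
  
  The rest makes sure that the definite descriptions in the definitions denote: weak compositions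
  can be sorted by a word in the adjacent transpositions, a partition is determined by the sizes of
  its level sets, and the divided differences are polynomials.
\<close>

section \<open>Exchanging two adjacent variables\<close>

abbreviation coeff :: "rpoly \<Rightarrow> (nat \<Rightarrow>\<^sub>0 nat) \<Rightarrow> rat"
  where "coeff f m \<equiv> Poly_Mapping.lookup f m"

abbreviation expo :: "(nat \<Rightarrow>\<^sub>0 nat) \<Rightarrow> nat \<Rightarrow> nat"
  where "expo m i \<equiv> Poly_Mapping.lookup m i"

abbreviation monomial :: "(nat \<Rightarrow>\<^sub>0 nat) \<Rightarrow> rpoly"
  where "monomial m \<equiv> Poly_Mapping.single m 1"

abbreviation swap_expo :: "nat \<Rightarrow> (nat \<Rightarrow>\<^sub>0 nat) \<Rightarrow> (nat \<Rightarrow>\<^sub>0 nat)"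
  where "swap_expo i \<equiv> Poly_Mapping.map_key (adj i)"

abbreviation swap_vars :: "nat \<Rightarrow> rpoly \<Rightarrow> rpoly"
  where "swap_vars i \<equiv> perm_poly (adj i)"

lemma adj_adj [simp]: "adj i (adj i j) = j"
  by (simp add: adj_def)

lemma inj_adj [simp]: "inj (adj i)"
  by (metis adj_adj injI)

lemma lookup_map_key_bij: "inj w \<Longrightarrow> Poly_Mapping.lookup (Poly_Mapping.map_key w m) i = Poly_Mapping.lookup m (w i)"
  by (simp add: map_key.rep_eq)

lemma swap_expo_swap_expo [simp]: "swap_expo i (swap_expo i m) = m"
  by (rule poly_mapping_eqI) (simp add: lookup_map_key_bij)

lemma inj_swap_expo [simp]: "inj (swap_expo i :: (nat \<Rightarrow>\<^sub>0 nat) \<Rightarrow> _)"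
  by (metis swap_expo_swap_expo injI)

lemma swap_expo_add: "swap_expo i (a + b) = swap_expo i a + swap_expo i b"
  by (simp add: map_key_plus)

lemma coeff_swap_vars: "coeff (swap_vars i f) m = coeff f (swap_expo i m)"
  by (simp add: perm_poly_def lookup_map_key_bij)

lemma swap_vars_add: "swap_vars i (f + g) = swap_vars i f + swap_vars i g"
  by (rule poly_mapping_eqI) (simp add: coeff_swap_vars lookup_add)

lemma swap_vars_diff: "swap_vars i (f - g) = swap_vars i f - swap_vars i g"
  by (rule poly_mapping_eqI) (simp add: coeff_swap_vars lookup_minus)

lemma swap_vars_swap_vars [simp]: "swap_vars i (swap_vars i f) = f"
  by (rule poly_mapping_eqI) (simp add: coeff_swap_vars)

lemma swap_vars_single: "swap_vars i (Poly_Mapping.single m c) = Poly_Mapping.single (swap_expo i m) c"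
  by (rule poly_mapping_eqI) (metis coeff_swap_vars lookup_single_eq lookup_single_not_eq swap_expo_swap_expo)

lemma poly_single_add_induct [case_names single add]:
  fixes P :: "('a \<Rightarrow>\<^sub>0 'b::monoid_add) \<Rightarrow> bool"
  assumes "\<And>m c. P (Poly_Mapping.single m c)" "\<And>f g. P f \<Longrightarrow> P g \<Longrightarrow> P (f + g)"
  shows "P f"
proof (induction f rule: update_induct)
  case const
  show ?case using assms(1)[of undefined 0] by simp
next
  case (update f a b)
  have "Poly_Mapping.update a b f = f + Poly_Mapping.single a b"
    using update by (intro poly_mapping_eqI) (auto simp: lookup_update lookup_add lookup_single when_def in_keys_iff)
  with assms update show ?case by simp
qed

text \<open>
  By bilinearity it is enough to look at monomials, where it is the additivity of the action on
  exponent vectors.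
\<close>

lemma swap_vars_mult: "swap_vars i (f * g) = swap_vars i f * swap_vars i g"
proof (induction f rule: poly_single_add_induct)
  case (single m c)
  show ?case
  proof (induction g rule: poly_single_add_induct)
    case (single m' c')
    show ?case by (simp add: mult_single swap_vars_single swap_expo_add)
  qed (simp add: distrib_left swap_vars_add)
qed (simp add: distrib_right swap_vars_add)

lemma swap_expo_single: "swap_expo i (Poly_Mapping.single j c) = Poly_Mapping.single (adj i j) c"
  by (metis adj_adj inj_adj map_key_single)

lemma swap_vars_var: "swap_vars i (var j) = var (adj i j)"
  by (simp add: var_def swap_vars_single swap_expo_single)

lemma swap_vars_one: "swap_vars i 1 = 1"
  using swap_vars_single[of i 0 1] by (simp flip: single_one)

lemma swap_vars_prod: "swap_vars i (\<Prod>a\<in>A. f a) = (\<Prod>a\<in>A. swap_vars i (f a))"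
  by (induction A rule: infinite_finite_induct) (simp_all add: swap_vars_one swap_vars_mult)

lemma adj_simps [simp]: "adj i i = Suc i" "adj i (Suc i) = i" "j \<noteq> i \<Longrightarrow> j \<noteq> Suc i \<Longrightarrow> adj i j = j"
  by (simp_all add: adj_def)

section \<open>Isobaric divided differences\<close>

lemma var_diff_nonzero: "i \<noteq> j \<Longrightarrow> var i - var j \<noteq> 0"
proof
  assume "i \<noteq> j" "var i - var j = 0"
  then have "coeff (var i) (Poly_Mapping.single i 1) = coeff (var j) (Poly_Mapping.single i 1)" by simp
  then have "Poly_Mapping.single j (1::nat) = Poly_Mapping.single i 1"
    by (simp add: var_def lookup_single when_def split: if_splits)
  then have "expo (Poly_Mapping.single j 1) i = expo (Poly_Mapping.single i 1) i" by simp
  with \<open>i \<noteq> j\<close> show False by (simp add: lookup_single)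
qed

lemma var_nonzero: "var i \<noteq> 0"
proof
  assume "var i = 0"
  then have "coeff (var i) (Poly_Mapping.single i 1) = 0" by simp
  then show False by (simp add: var_def)
qed

text \<open>
  This is what makes the divided difference a polynomial. The twisted Leibniz rule
  \<open>f g - s f s g = (f - s f) g + s f (g - s g)\<close> reduces it to powers of a single variable.
\<close>

lemma var_diff_dvd_swap_diff: "(var i - var (Suc i)) dvd (f - swap_vars i f)"
proof (induction f rule: poly_single_add_induct)
  case (single m c)
  have mon: "(var i - var (Suc i)) dvd (monomial m - swap_vars i (monomial m))" for m
  proof (induction m rule: poly_single_add_induct)
    case (single j k)
    have "Poly_Mapping.single (Poly_Mapping.single j k) 1 = var j ^ k"
    proof (induction k)
      case (Suc k)
      have "monomial (Poly_Mapping.single j (Suc k)) = var j * monomial (Poly_Mapping.single j k)"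
        by (simp add: var_def mult_single flip: single_add)
      with Suc show ?case by simp
    qed simp
    moreover have "swap_vars i (var j ^ k) = var (adj i j) ^ k"
      by (induction k) (simp_all add: swap_vars_one swap_vars_mult swap_vars_var)
    moreover have "(var i - var (Suc i)) dvd (var j - var (adj i j))"
    proof -
      consider "j = i" | "j = Suc i" | "j \<noteq> i" "j \<noteq> Suc i" by blast
      then show ?thesis
        by cases (simp, metis adj_simps(2) dvd_refl dvd_minus_iff minus_diff_eq, simp)
    qed
    moreover have "(var j - var (adj i j)) dvd (var j ^ k - var (adj i j) ^ k)"
      by (metis dvd_triv_left power_diff_sumr2)
    ultimately show ?case by (metis dvd_trans)
  next
    case (add f g)
    have "monomial (f + g) = monomial f * monomial g" by (simp add: mult_single)
    then have "monomial (f + g) - swap_vars i (monomial (f + g)) =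
       (monomial f - swap_vars i (monomial f)) * monomial g
       + swap_vars i (monomial f) * (monomial g - swap_vars i (monomial g))"
      by (simp add: swap_vars_mult algebra_simps del: mult_single)
    with add show ?case by simp
  qed
  have "Poly_Mapping.single m c - swap_vars i (Poly_Mapping.single m c) =
     Poly_Mapping.single 0 c * (monomial m - swap_vars i (monomial m))"
    by (simp add: swap_vars_single right_diff_distrib mult_single)
  with mon show ?case by simp
next
  case (add f g)
  have "f + g - swap_vars i (f + g) = (f - swap_vars i f) + (g - swap_vars i g)"
    by (simp add: swap_vars_add)
  with add show ?case by (simp only: dvd_add)
qed

lemma demazure_eq:
  "(var i - var (Suc i)) * demazure i f = var i * f - var (Suc i) * swap_vars i f"
proof -
  let ?P = "\<lambda>g. (var i - var (i + 1)) * g = var i * f - var (i + 1) * swap_vars i f"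
  obtain h where h: "f - swap_vars i f = (var i - var (Suc i)) * h"
    using var_diff_dvd_swap_diff by blast
  have "var i * f - var (Suc i) * swap_vars i f
     = (var i - var (Suc i)) * f + var (Suc i) * (f - swap_vars i f)"
    by (simp add: algebra_simps)
  then have ex: "?P (f + var (Suc i) * h)"
    by (simp add: h algebra_simps)
  have "?P (THE g. ?P g)"
  proof (rule theI[of ?P])
    fix g assume "?P g"
    with ex have "(var i - var (i + 1)) * g = (var i - var (i + 1)) * (f + var (Suc i) * h)"
      by simp
    then show "g = f + var (Suc i) * h"
      using var_diff_nonzero[of i "i + 1"] by (subst (asm) mult_left_cancel) simp_all
  qed (fact ex)
  then show ?thesis by (simp add: demazure_def)
qed

lemma swap_vars_demazure: "swap_vars i (demazure i f) = demazure i f"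
proof -
  have "swap_vars i ((var i - var (Suc i)) * demazure i f)
      = swap_vars i (var i * f - var (Suc i) * swap_vars i f)"
    by (simp add: demazure_eq)
  then have "(var (Suc i) - var i) * swap_vars i (demazure i f) = var (Suc i) * swap_vars i f - var i * f"
    by (simp add: swap_vars_mult swap_vars_diff swap_vars_var)
  then have "- ((var i - var (Suc i)) * swap_vars i (demazure i f)) = - (var i * f - var (Suc i) * swap_vars i f)"
    by (simp only: minus_diff_eq mult_minus_left[symmetric])
  then have "(var i - var (Suc i)) * swap_vars i (demazure i f) = (var i - var (Suc i)) * demazure i f"
    by (simp only: neg_equal_iff_equal demazure_eq)
  then show ?thesis using var_diff_nonzero[of i "Suc i"] by simp
qed

text \<open>
  In other words \<open>f - \<pi>_i f\<close> is \<open>x_(i+1)\<close> times a polynomial symmetric in \<open>x_i\<close> and \<open>x_(i+1)\<close>,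
  but the equation is in a form that needs no division.
\<close>

lemma var_mult_demazure_defect:
  "var i * (f - demazure i f) = var (Suc i) * swap_vars i (f - demazure i f)"
  using demazure_eq[of i f] by (simp add: swap_vars_diff swap_vars_demazure algebra_simps)

section \<open>Monomials, staircases and degrees\<close>

lemma coeff_monomial_mult: "coeff (monomial t * f) (t + m) = coeff f m"
proof (induction f rule: poly_single_add_induct)
  case (single m' c)
  then show ?case by (simp add: mult_single lookup_single when_def)
qed (simp add: distrib_left lookup_add)

lemma coeff_scale: "coeff (poly_scale c f) m = c * coeff f m"
  unfolding poly_scale_def
proof (induction f rule: poly_single_add_induct)
  case (single m' c')
  then show ?case by (simp add: mult_single lookup_single when_def)
qed (simp add: distrib_left lookup_add)

lemma module_poly_scale: "module poly_scale"
  by standard (auto intro!: poly_mapping_eqI simp: coeff_scale lookup_add algebra_simps)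

lemma keys_monomial_mult:
  assumes "M \<in> Poly_Mapping.keys (monomial t * f)"
  obtains m where "m \<in> Poly_Mapping.keys f" "M = t + m"
  using keys_mult[of "monomial t" f] assms by (auto split: if_splits)

lemma keys_var_mult:
  assumes "M \<in> Poly_Mapping.keys (var i * f)"
  obtains m where "m \<in> Poly_Mapping.keys f" "M = Poly_Mapping.single i 1 + m"
  using keys_monomial_mult assms unfolding var_def by blast

definition ones :: "nat \<Rightarrow> (nat \<Rightarrow>\<^sub>0 nat)"
  where "ones n = (\<Sum>i\<in>{1..n}. Poly_Mapping.single i 1)"

text \<open>
  Position \<open>i \<ge> 1\<close> of \<open>staircase n\<close> holds \<open>n - i\<close>, truncated at \<open>0\<close>. For \<open>n \<ge> 1\<close> the entries at
  \<open>n\<close> and \<open>n + 1\<close> are therefore both \<open>0\<close>, while before them each entry exceeds the next by one.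
\<close>

definition staircase :: "nat \<Rightarrow> (nat \<Rightarrow>\<^sub>0 nat)"
  where "staircase n = (\<Sum>k<n. ones k)"

lemma expo_ones: "expo (ones n) i = (if 1 \<le> i \<and> i \<le> n then 1 else 0)"
  by (induction n) (auto simp: ones_def lookup_add lookup_single when_def)

lemma expo_staircase: "expo (staircase n) i = (if i = 0 then 0 else n - i)"
  by (induction n) (auto simp: staircase_def lookup_add expo_ones)

lemma staircase_Suc: "staircase (Suc n) = staircase n + ones n"
  by (simp add: staircase_def)

lemma prod_var_eq_monomial_ones: "(\<Prod>k\<in>{1..n}. var k) = monomial (ones n)"
proof (induction n)
  case 0
  show ?case by (simp add: ones_def)
next
  case (Suc n)
  then show ?case by (simp add: ones_def var_def mult_single)
qed

definition mdeg :: "(nat \<Rightarrow>\<^sub>0 nat) \<Rightarrow> nat"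
  where "mdeg m = (\<Sum>i\<in>Poly_Mapping.keys m. expo m i)"

lemma mdeg_superset: "finite A \<Longrightarrow> Poly_Mapping.keys m \<subseteq> A \<Longrightarrow> mdeg m = (\<Sum>i\<in>A. expo m i)"
  unfolding mdeg_def by (rule sum.mono_neutral_left) (auto simp: in_keys_iff)

lemma mdeg_add: "mdeg (a + b) = mdeg a + mdeg b"
proof -
  let ?A = "Poly_Mapping.keys a \<union> Poly_Mapping.keys b"
  have "mdeg (a + b) = (\<Sum>i\<in>?A. expo (a + b) i)" "mdeg a = (\<Sum>i\<in>?A. expo a i)" "mdeg b = (\<Sum>i\<in>?A. expo b i)"
    using keys_add[of a b] by (auto intro!: mdeg_superset)
  then show ?thesis by (simp add: lookup_add sum.distrib)
qed

lemma mdeg_single: "mdeg (Poly_Mapping.single i c) = c"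
  by (simp add: mdeg_def)

lemma mdeg_ones: "mdeg (ones n) = n"
proof -
  have "mdeg (ones n) = (\<Sum>i\<in>{1..n}. expo (ones n) i)"
    by (rule mdeg_superset) (auto simp: in_keys_iff expo_ones split: if_splits)
  then show ?thesis by (simp add: expo_ones)
qed

lemma mdeg_map_key:
  assumes "bij w" shows "mdeg (Poly_Mapping.map_key w m) = mdeg m"
proof -
  have "bij_betw w (w -` Poly_Mapping.keys m) (Poly_Mapping.keys m)"
    using assms unfolding bij_betw_def by (auto simp: inj_on_def surj_image_vimage_eq dest: injD)
  then have "(\<Sum>i\<in>w -` Poly_Mapping.keys m. expo m (w i)) = mdeg m"
    unfolding mdeg_def by (rule sum.reindex_bij_betw)
  then show ?thesis
    using bij_is_inj[OF assms] by (simp add: mdeg_def keys_map_key lookup_map_key_bij)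
qed

definition homogeneous :: "nat \<Rightarrow> rpoly \<Rightarrow> bool"
  where "homogeneous d f \<longleftrightarrow> (\<forall>m\<in>Poly_Mapping.keys f. mdeg m = d)"

lemma homogeneous_var: "homogeneous 1 (var i)"
  by (simp add: homogeneous_def var_def mdeg_single)

lemma homogeneous_add: "homogeneous d f \<Longrightarrow> homogeneous d g \<Longrightarrow> homogeneous d (f + g)"
  using keys_add[of f g] by (auto simp: homogeneous_def)

lemma homogeneous_var_add: "homogeneous 1 (var i + var j)"
  by (intro homogeneous_add homogeneous_var)

lemma homogeneous_mult: "homogeneous d f \<Longrightarrow> homogeneous e g \<Longrightarrow> homogeneous (d + e) (f * g)"
  using keys_mult[of f g] by (force simp: homogeneous_def mdeg_add)

lemma homogeneous_prod:
  assumes "\<And>a. a \<in> A \<Longrightarrow> homogeneous 1 (f a)" "finite A"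
  shows "homogeneous (card A) (\<Prod>a\<in>A. f a)"
  using assms(2,1)
proof (induction A)
  case empty
  then show ?case by (simp add: homogeneous_def mdeg_def flip: single_one)
next
  case (insert a A)
  then show ?case using homogeneous_mult[of 1 "f a" "card A"] by simp
qed

lemma total_degree_homogeneous:
  assumes "homogeneous d f" "f \<noteq> 0"
  shows "total_degree f = d"
proof -
  obtain m where "m \<in> Poly_Mapping.keys f"
    using assms(2) by (metis equals0I keys_eq_empty)
  then have "(\<lambda>m. \<Sum>i\<in>Poly_Mapping.keys m. expo m i) ` Poly_Mapping.keys f = {d}"
    using assms(1) by (auto simp: homogeneous_def mdeg_def image_iff)
  then show ?thesis by (simp add: total_degree_def)
qed

section \<open>The alternating functional\<close>

text \<open>
  For polynomials in \<open>x_1, \<dots>, x_n\<close> this is the coefficient of the Vandermonde monomial in the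
  antisymmetrization of \<open>F\<close>.
\<close>

definition alt_coeff :: "nat \<Rightarrow> rpoly \<Rightarrow> rat"
  where "alt_coeff n F = (\<Sum>\<sigma> | \<sigma> permutes {1..n}.
    of_int (sign \<sigma>) * coeff F (Poly_Mapping.map_key \<sigma> (staircase n)))"

text \<open>
  The coefficient of \<open>x_1 \<dots> x_n\<close>, the key polynomial of \<open>(1^n)\<close>, in the expansion of \<open>f\<close>
  into key polynomials.
\<close>

definition key_coeff :: "nat \<Rightarrow> rpoly \<Rightarrow> rat"
  where "key_coeff n f = alt_coeff (Suc n) (monomial (staircase n) * f)"

lemma key_coeff_add: "key_coeff n (f + g) = key_coeff n f + key_coeff n g"
  by (simp add: key_coeff_def alt_coeff_def distrib_left lookup_add sum.distrib)

lemma key_coeff_diff: "key_coeff n (f - g) = key_coeff n f - key_coeff n g"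
  using key_coeff_add[of n "f - g" g] by simp

text \<open>
  Composing the permutations with the transposition leaves the coefficients of a symmetric \<open>F\<close>
  unchanged but reverses all signs.
\<close>

lemma alt_coeff_symmetric:
  assumes "swap_vars i F = F" "1 \<le> i" "i < n"
  shows "alt_coeff n F = 0"
proof -
  let ?S = "{\<sigma>. \<sigma> permutes {1..n}}"
  let ?t = "\<lambda>\<sigma>. of_int (sign \<sigma>) * coeff F (Poly_Mapping.map_key \<sigma> (staircase n))"
  have per: "adj i permutes {1..n}"
    unfolding adj_def using assms by (intro permutes_swap_id) auto
  have "?t (\<sigma> \<circ> adj i) = - ?t \<sigma>" if \<sigma>: "\<sigma> permutes {1..n}" for \<sigma>
  proof -
    have "sign (\<sigma> \<circ> adj i) = - sign \<sigma>"
      using \<sigma> per by (subst sign_compose)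
        (auto simp: adj_def sign_swap_id permutation_swap_id intro: permutation_permutes[THEN iffD2])
    moreover have "Poly_Mapping.map_key (\<sigma> \<circ> adj i) (staircase n) = swap_expo i (Poly_Mapping.map_key \<sigma> (staircase n))"
      using permutes_inj[OF \<sigma>] by (simp add: map_key_compose)
    moreover have "coeff F (swap_expo i m) = coeff F m" for m
      by (metis assms(1) coeff_swap_vars)
    ultimately show ?thesis by simp
  qed
  then have "(\<Sum>\<sigma>\<in>?S. ?t (\<sigma> \<circ> adj i)) = - alt_coeff n F"
    unfolding alt_coeff_def sum_negf[symmetric] by (intro sum.cong) auto
  moreover have "(\<Sum>\<sigma>\<in>?S. ?t (\<sigma> \<circ> adj i)) = alt_coeff n F"
    unfolding alt_coeff_def using sum_permutations_compose_right[OF per, of ?t] by simp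
  ultimately show ?thesis by simp
qed

lemma alt_coeff_zeroI:
  assumes "\<And>\<sigma>. \<sigma> permutes {1..n} \<Longrightarrow> coeff F (Poly_Mapping.map_key \<sigma> (staircase n)) = 0"
  shows "alt_coeff n F = 0"
  using assms by (simp add: alt_coeff_def)

lemma key_coeff_scale: "key_coeff n (poly_scale c f) = c * key_coeff n f"
proof -
  have "monomial t * poly_scale c f = poly_scale c (monomial t * f)" for t
    by (simp add: poly_scale_def mult.left_commute)
  then show ?thesis
    by (simp add: key_coeff_def alt_coeff_def coeff_scale sum_distrib_left mult.left_commute)
qed

text \<open>
  The exponent vector \<open>staircase n\<close> is fixed by the exchange of \<open>n\<close> and \<open>n + 1\<close>, so multiplying by
  its monomial keeps the symmetry.
\<close>

lemma key_coeff_symmetric: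
  assumes "swap_vars n g = g" "1 \<le> n"
  shows "key_coeff n g = 0"
proof -
  have "swap_expo n (staircase n) = staircase n"
  proof (rule poly_mapping_eqI)
    fix k
    show "expo (swap_expo n (staircase n)) k = expo (staircase n) k"
      using assms(2) by (cases "k = n \<or> k = Suc n") (auto simp: lookup_map_key_bij expo_staircase)
  qed
  then have "swap_vars n (monomial (staircase n) * g) = monomial (staircase n) * g"
    by (simp add: swap_vars_mult swap_vars_single assms(1))
  then show ?thesis
    unfolding key_coeff_def using assms(2) by (intro alt_coeff_symmetric) auto
qed

text \<open>
  For \<open>i < n\<close> the staircase drops by one between \<open>i\<close> and \<open>i + 1\<close>. The hypothesis on \<open>d\<close> compensates
  exactly this drop: multiplied by the staircase monomial, \<open>d\<close> becomes symmetric.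
\<close>

lemma key_coeff_antisymmetric:
  assumes d: "var i * d = var (Suc i) * swap_vars i d" and i: "1 \<le> i" "i < n"
  shows "key_coeff n d = 0"
proof -
  let ?x = "monomial (staircase n)"
  have st: "Poly_Mapping.single i 1 + swap_expo i (staircase n) = Poly_Mapping.single (Suc i) 1 + staircase n"
  proof (rule poly_mapping_eqI)
    fix k
    show "expo (Poly_Mapping.single i 1 + swap_expo i (staircase n)) k
      = expo (Poly_Mapping.single (Suc i) 1 + staircase n) k"
      using i by (cases "k = i \<or> k = Suc i")
        (auto simp: lookup_map_key_bij expo_staircase lookup_add lookup_single)
  qed
  have x: "var i * swap_vars i ?x = var (Suc i) * ?x"
    unfolding var_def swap_vars_single mult_single st by simp
  have "var i * swap_vars i (?x * d) = (var i * swap_vars i ?x) * swap_vars i d"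
    by (simp only: swap_vars_mult mult.assoc)
  also have "\<dots> = ?x * (var (Suc i) * swap_vars i d)"
    by (simp only: x mult_ac)
  also have "\<dots> = var i * (?x * d)"
    unfolding d[symmetric] by (rule mult.left_commute)
  finally have "swap_vars i (?x * d) = ?x * d"
    using var_nonzero by (subst (asm) mult_left_cancel) simp_all
  then show ?thesis
    unfolding key_coeff_def using i by (intro alt_coeff_symmetric) auto
qed

lemma key_coeff_var_symmetric:
  assumes "swap_vars i h = h" "1 \<le> i" "i < n"
  shows "key_coeff n (var (Suc i) * h) = 0"
  using assms by (intro key_coeff_antisymmetric[of i]) (simp_all add: swap_vars_mult swap_vars_var mult_ac)

text \<open>
  A monomial \<open>m\<close> of \<open>f\<close> contributes only if adding the staircase \<open>(n-1, \<dots>, 0, 0)\<close> to it gives a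
  rearrangement of \<open>(n, \<dots>, 1, 0)\<close>; the equations say this position by position.
\<close>

lemma key_coeff_zeroI:
  assumes "\<And>\<sigma> m. \<lbrakk>\<sigma> permutes {1..Suc n}; m \<in> Poly_Mapping.keys f;
    \<And>k. 1 \<le> k \<Longrightarrow> Suc n - \<sigma> k = n - k + expo m k\<rbrakk> \<Longrightarrow> False"
  shows "key_coeff n f = 0"
  unfolding key_coeff_def
proof (rule alt_coeff_zeroI, rule ccontr)
  fix \<sigma> assume \<sigma>: "\<sigma> permutes {1..Suc n}"
    and nz: "coeff (monomial (staircase n) * f) (Poly_Mapping.map_key \<sigma> (staircase (Suc n))) \<noteq> 0"
  obtain m where m: "m \<in> Poly_Mapping.keys f"
    "Poly_Mapping.map_key \<sigma> (staircase (Suc n)) = staircase n + m"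
    using keys_monomial_mult[OF in_keys_iff[THEN iffD2, OF nz]] by blast
  show False
  proof (rule assms[OF \<sigma> m(1)])
    fix k :: nat assume k: "1 \<le> k"
    have "\<sigma> k \<noteq> 0"
      using k \<sigma> by (metis atLeastAtMost_iff not_one_le_zero permutes_not_in permutes_inj inj_eq)
    have "expo (Poly_Mapping.map_key \<sigma> (staircase (Suc n))) k = expo (staircase n + m) k"
      by (simp add: m)
    with k \<open>\<sigma> k \<noteq> 0\<close> show "Suc n - \<sigma> k = n - k + expo m k"
      by (simp add: lookup_map_key_bij permutes_inj[OF \<sigma>] expo_staircase lookup_add)
  qed
qed

text \<open>
  This mirrors the action of \<open>\<pi>_i\<close> on key polynomials, which sends \<open>\<kappa>_\<beta>\<close> to \<open>\<kappa>_\<beta>\<close> or to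
  \<open>\<kappa>_(s_i \<beta>)\<close> with \<open>s_i \<beta>\<close> farther from sorted: \<open>\<kappa>_(1^n)\<close> is never newly produced, and only \<open>\<pi>_n\<close>
  destroys it.
\<close>

lemma key_coeff_demazure:
  assumes "1 \<le> n" "1 \<le> i"
  shows "key_coeff n (demazure i f) = (if i = n then 0 else key_coeff n f)"
proof -
  consider "i = n" | "i < n" | "n < i" by linarith
  then show ?thesis
  proof cases
    case 1
    then show ?thesis using key_coeff_symmetric[OF swap_vars_demazure] assms by simp
  next
    case 2
    then have "key_coeff n (f - demazure i f) = 0"
      using assms by (intro key_coeff_antisymmetric[OF var_mult_demazure_defect])
    with 2 show ?thesis by (simp add: key_coeff_diff)
  next
    case 3
    \<comment> \<open>All monomials of the defect involve \<open>x_(i+1)\<close>, whose index exceeds \<open>n + 1\<close>.\<close>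
    have "key_coeff n (f - demazure i f) = 0"
    proof (rule key_coeff_zeroI)
      fix \<sigma> m assume \<sigma>: "\<sigma> permutes {1..Suc n}" and m: "m \<in> Poly_Mapping.keys (f - demazure i f)"
        and eq: "\<And>k. 1 \<le> k \<Longrightarrow> Suc n - \<sigma> k = n - k + expo m k"
      have "\<sigma> (Suc i) = Suc i" using \<sigma> 3 by (simp add: permutes_not_in)
      then have m0: "expo m (Suc i) = 0" using eq[of "Suc i"] 3 by simp
      have "coeff (var (Suc i) * swap_vars i (f - demazure i f)) (Poly_Mapping.single i 1 + m) \<noteq> 0"
        unfolding var_mult_demazure_defect[symmetric] unfolding var_def coeff_monomial_mult
        using m by (simp only: in_keys_iff) simp
      then have "Poly_Mapping.single i 1 + m \<in> Poly_Mapping.keys (var (Suc i) * swap_vars i (f - demazure i f))"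
        by (simp add: in_keys_iff)
      then obtain m' where "Poly_Mapping.single i 1 + m = Poly_Mapping.single (Suc i) 1 + m'"
        by (rule keys_var_mult)
      then have "expo (Poly_Mapping.single i 1 + m) (Suc i) = expo (Poly_Mapping.single (Suc i) 1 + m') (Suc i)"
        by simp
      with m0 show False by (simp add: lookup_add lookup_single)
    qed
    with 3 show ?thesis by (simp add: key_coeff_diff)
  qed
qed

lemma key_coeff_foldr_demazure:
  assumes "1 \<le> n" "ws \<in> lists {1..}" "key_coeff n f = 0"
  shows "key_coeff n (foldr demazure ws f) = 0"
  using assms(2) by (induction ws) (use assms in \<open>auto simp: key_coeff_demazure\<close>)

text \<open>
  The product with the staircase monomial is the monomial of \<open>staircase (n + 1)\<close>, whose entries at
  the positions \<open>1, \<dots>, n + 1\<close> are distinct, so only the identity contributes.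
\<close>

lemma key_coeff_ones: "key_coeff n (monomial (ones n)) = 1"
proof -
  have "monomial (staircase n) * monomial (ones n) = monomial (staircase (Suc n))"
    by (simp add: mult_single staircase_Suc)
  moreover have "coeff (monomial (staircase (Suc n))) (Poly_Mapping.map_key \<sigma> (staircase (Suc n)))
     = (if \<sigma> = id then 1 else 0)" if \<sigma>: "\<sigma> permutes {1..Suc n}" for \<sigma>
  proof -
    have "\<sigma> = id" if "Poly_Mapping.map_key \<sigma> (staircase (Suc n)) = staircase (Suc n)"
    proof
      fix k
      have "expo (Poly_Mapping.map_key \<sigma> (staircase (Suc n))) k = expo (staircase (Suc n)) k"
        by (simp add: that)
      then have "expo (staircase (Suc n)) (\<sigma> k) = expo (staircase (Suc n)) k"
        by (simp add: lookup_map_key_bij permutes_inj[OF \<sigma>])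
      moreover have "k \<notin> {1..Suc n} \<Longrightarrow> \<sigma> k = k" "k \<in> {1..Suc n} \<Longrightarrow> \<sigma> k \<in> {1..Suc n}"
        using \<sigma> permutes_in_image[OF \<sigma>] by (auto simp: permutes_not_in)
      ultimately show "\<sigma> k = id k"
        by (cases "k \<in> {1..Suc n}") (auto simp: expo_staircase split: if_splits)
    qed
    moreover have "Poly_Mapping.map_key id m = m" for m :: "nat \<Rightarrow>\<^sub>0 nat"
      using map_key_id[of m] by (simp add: id_def)
    ultimately show ?thesis by (auto simp: lookup_single when_def)
  qed
  ultimately have "key_coeff n (monomial (ones n)) =
      (\<Sum>\<sigma> | \<sigma> permutes {1..Suc n}. if \<sigma> = id then 1 else 0)"
    unfolding key_coeff_def alt_coeff_def by (intro sum.cong) (auto simp: sign_id)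
  then show ?thesis
    by (simp add: finite_permutations permutes_id)
qed

text \<open>
  The entries of \<open>staircase (n + 1)\<close> add up to \<open>n\<close> more than those of \<open>staircase n\<close>.
\<close>

lemma key_coeff_homogeneous:
  assumes "homogeneous d f" "d \<noteq> n"
  shows "key_coeff n f = 0"
  unfolding key_coeff_def
proof (rule alt_coeff_zeroI, rule ccontr)
  fix \<sigma> assume \<sigma>: "\<sigma> permutes {1..Suc n}"
    and nz: "coeff (monomial (staircase n) * f) (Poly_Mapping.map_key \<sigma> (staircase (Suc n))) \<noteq> 0"
  obtain m where m: "m \<in> Poly_Mapping.keys f"
    "Poly_Mapping.map_key \<sigma> (staircase (Suc n)) = staircase n + m"
    using keys_monomial_mult[OF in_keys_iff[THEN iffD2, OF nz]] by blast
  have "mdeg (staircase (Suc n)) = mdeg (staircase n) + mdeg m"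
    using m(2) by (metis mdeg_map_key[OF permutes_bij[OF \<sigma>]] mdeg_add)
  then have "mdeg m = n" by (simp add: staircase_Suc mdeg_add mdeg_ones)
  with m assms show False by (simp add: homogeneous_def)
qed

section \<open>The functional on single rows\<close>

text \<open>
  The product attached to \<open>\<mu> = (n)\<close> is \<open>row_prod (n + 1)\<close> in the family P and
  \<open>2 x_1 row_prod n\<close> in the family Q.
\<close>

definition row_prod :: "nat \<Rightarrow> rpoly"
  where "row_prod m = (\<Prod>k\<in>{2..m}. var 1 + var k)"

lemma swap_vars_row_prod:
  assumes "2 \<le> i" "i < m"
  shows "swap_vars i (row_prod m) = row_prod m"
proof -
  have "adj i permutes {2..m}"
    unfolding adj_def using assms by (intro permutes_swap_id) auto
  then have bij: "bij_betw (adj i) {2..m} {2..m}" by (rule permutes_imp_bij)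
  have "swap_vars i (row_prod m) = (\<Prod>k\<in>{2..m}. var 1 + var (adj i k))"
    using assms by (simp add: row_prod_def swap_vars_prod swap_vars_add swap_vars_var)
  also have "\<dots> = row_prod m"
    unfolding row_prod_def by (rule prod.reindex_bij_betw[OF bij])
  finally show ?thesis .
qed

lemma prod_var_add_expand:
  assumes "finite A"
  shows "\<exists>R. (\<Prod>k\<in>A. var 1 + var k) = (\<Prod>k\<in>A. var k) + var 1 * R"
  using assms
proof (induction A)
  case empty
  show ?case by (intro exI[of _ 0]) simp
next
  case (insert a A)
  then obtain R where R: "(\<Prod>k\<in>A. var 1 + var k) = (\<Prod>k\<in>A. var k) + var 1 * R" by blast
  show ?case
    using insert(1,2) by (intro exI[of _ "(\<Prod>k\<in>A. var k) + var 1 * R + var a * R"])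
      (simp add: R del: One_nat_def, simp add: algebra_simps)
qed

text \<open>
  The staircase already contributes \<open>n - 1\<close> to the exponent of \<open>x_1\<close>, and exponents above \<open>n\<close> do not
  occur in a rearrangement of \<open>(n, \<dots>, 1, 0)\<close>.
\<close>

lemma key_coeff_var_1_1: "1 \<le> n \<Longrightarrow> key_coeff n (var 1 * (var 1 * R)) = 0"
proof (rule key_coeff_zeroI)
  fix \<sigma> m assume "1 \<le> n" and \<sigma>: "\<sigma> permutes {1..Suc n}" and m: "m \<in> Poly_Mapping.keys (var 1 * (var 1 * R))"
    and eq: "\<And>k. 1 \<le> k \<Longrightarrow> Suc n - \<sigma> k = n - k + expo m k"
  from m obtain m' where "m = Poly_Mapping.single 1 1 + (Poly_Mapping.single 1 1 + m')"
    by (metis keys_var_mult)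
  then have "2 \<le> expo m 1" by (simp add: lookup_add)
  moreover have "\<sigma> 1 \<in> {1..Suc n}" using permutes_in_image[OF \<sigma>] by simp
  ultimately show False using eq[of 1] \<open>1 \<le> n\<close> unfolding atLeastAtMost_iff by arith
qed

text \<open>
  Together with the staircase, the exponents of both \<open>x_1\<close> and \<open>x_2\<close> are at least \<open>n\<close>, but only one entry of
  a rearrangement of \<open>(n, \<dots>, 1, 0)\<close> can be that large.
\<close>

lemma key_coeff_var_1_2_2: "2 \<le> n \<Longrightarrow> key_coeff n (var 1 * (var 2 * (var 2 * R))) = 0"
proof (rule key_coeff_zeroI)
  fix \<sigma> m assume n: "2 \<le> n" and \<sigma>: "\<sigma> permutes {1..Suc n}"
    and m: "m \<in> Poly_Mapping.keys (var 1 * (var 2 * (var 2 * R)))"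
    and eq: "\<And>k. 1 \<le> k \<Longrightarrow> Suc n - \<sigma> k = n - k + expo m k"
  from m obtain m' where
    "m = Poly_Mapping.single 1 1 + (Poly_Mapping.single 2 1 + (Poly_Mapping.single 2 1 + m'))"
    by (metis keys_var_mult)
  then have "1 \<le> expo m 1" "2 \<le> expo m 2" by (simp_all add: lookup_add)
  moreover have "\<sigma> 1 \<in> {1..Suc n}" "\<sigma> 2 \<in> {1..Suc n}" using permutes_in_image[OF \<sigma>] n by simp_all
  ultimately have "\<sigma> 1 = 1" "\<sigma> 2 = 1"
    using eq[of 1] eq[of 2] n unfolding atLeastAtMost_iff by arith+
  then show False using injD[OF permutes_inj[OF \<sigma>], of 1 2] by simp
qed

text \<open>
  The product belongs to \<open>\<mu> = (n-1, 1)\<close>. The part with the factor \<open>x_3\<close> vanishes because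
  \<open>row_prod n\<close> is symmetric in \<open>x_2\<close> and \<open>x_3\<close>. In the part with the factor \<open>x_2\<close>, write
  \<open>row_prod n\<close> as \<open>(x_1 + x_2) (M + x_1 R)\<close> with \<open>M = x_3 \<dots> x_n\<close>: now \<open>(x_1 + x_2) M\<close> is symmetric
  in \<open>x_1\<close> and \<open>x_2\<close>, and the terms with \<open>R\<close> have too large exponents.
\<close>

lemma key_coeff_row_prod_mult:
  assumes "3 \<le> n"
  shows "key_coeff n (row_prod n * (var 2 + var 3)) = 0"
proof -
  let ?M = "\<Prod>k\<in>{3..n}. var k"
  obtain R where R: "(\<Prod>k\<in>{3..n}. var 1 + var k) = ?M + var 1 * R"
    using prod_var_add_expand[of "{3..n}"] by auto
  have "{2..n} = insert 2 {3..n}" using assms by auto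
  then have row: "row_prod n = (var 1 + var 2) * (?M + var 1 * R)"
    by (simp add: row_prod_def R del: One_nat_def)
  have "row_prod n * (var 2 + var 3) = var 3 * row_prod n + (var 2 * ((var 1 + var 2) * ?M)
      + (var 1 * (var 1 * (var 2 * R)) + var 1 * (var 2 * (var 2 * R))))"
    unfolding row by (simp add: algebra_simps)
  moreover have "key_coeff n (var 3 * row_prod n) = 0"
    using key_coeff_var_symmetric[of 2 "row_prod n" n] swap_vars_row_prod[of 2 n] assms by (simp add: numeral_3_eq_3 numeral_2_eq_2)
  moreover have "key_coeff n (var 2 * ((var 1 + var 2) * ?M)) = 0"
  proof -
    have "swap_vars 1 ?M = ?M"
      by (simp add: swap_vars_prod swap_vars_var)
    moreover have "swap_vars 1 (var 1 + var 2) = var 1 + var 2"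
      using adj_simps(1)[of 1] adj_simps(2)[of 1]
      by (simp add: swap_vars_add swap_vars_var numeral_2_eq_2 add.commute)
    ultimately have "swap_vars 1 ((var 1 + var 2) * ?M) = (var 1 + var 2) * ?M"
      by (simp add: swap_vars_mult)
    then show ?thesis
      using key_coeff_var_symmetric[of 1 _ n] assms by (simp add: numeral_2_eq_2)
  qed
  ultimately show ?thesis
    using assms by (simp only: key_coeff_add) (simp add: key_coeff_var_1_1[simplified] key_coeff_var_1_2_2[simplified])
qed

section \<open>The shifted diagram products of type P\<close>

lemma diagram_eq_Sigma: "weak_comp \<mu> \<Longrightarrow> diagram \<mu> = Sigma (Poly_Mapping.keys \<mu>) (\<lambda>i. {1..expo \<mu> i})"
  by (auto simp: diagram_def weak_comp_def in_keys_iff Suc_le_eq intro!: gr0I)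

text \<open>
  Row \<open>i\<close> of the shifted diagram ends in column \<open>\<mu>_i + i - 1\<close>, and the rows of a strict partition
  do not extend beyond the first one.
\<close>

lemma strict_first_part:
  assumes "is_strict \<mu>" "1 \<le> i" "1 \<le> expo \<mu> i"
  shows "expo \<mu> i + i \<le> expo \<mu> 1 + 1"
  using assms(2,3)
proof (induction i rule: dec_induct)
  case (step i)
  have le: "expo \<mu> (Suc i) \<le> expo \<mu> i"
    using assms(1) step.hyps by (simp add: is_strict_def is_partition_def)
  moreover have "expo \<mu> (Suc i) \<noteq> expo \<mu> i"
  proof
    assume eq: "expo \<mu> (Suc i) = expo \<mu> i"
    then have "i \<in> Poly_Mapping.keys \<mu>" "Suc i \<in> Poly_Mapping.keys \<mu>"
      using step.prems by (simp_all add: in_keys_iff)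
    then show False
      using inj_onD[of "expo \<mu>" "Poly_Mapping.keys \<mu>", OF _ eq] assms(1) by (simp add: is_strict_def)
  qed
  ultimately show ?case using step by simp
qed simp

text \<open>
  If \<open>|\<mu>| = n\<close> and one of the variables \<open>x_n\<close>, \<open>x_(n+1)\<close> occurs, then the first row has at least
  \<open>n - 1\<close> boxes. At most one box remains, so \<open>\<mu>\<close> is \<open>(n)\<close> or \<open>(n-1, 1)\<close>.
\<close>

lemma key_coeff_diagram_prod:
  assumes \<mu>: "is_strict \<mu>" and n: "1 \<le> n"
  shows "key_coeff n (\<Prod>(i, j)\<in>diagram \<mu>. var i + var (i + j)) = 0"
proof -
  let ?D = "diagram \<mu>" and ?P = "\<Prod>(i, j)\<in>diagram \<mu>. var i + var (i + j)"
  have part: "is_partition \<mu>" using \<mu> by (simp add: is_strict_def)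
  have fin: "finite ?D" using part by (simp add: diagram_eq_Sigma is_partition_def)
  \<comment> \<open>The factor of the box \<open>(i, j)\<close> has its largest index equal to \<open>i + j\<close>.\<close>
  consider (degree) "card ?D \<noteq> n" | (few_vars) "\<forall>(i, j)\<in>?D. i + j < n"
    | (large) i j where "card ?D = n" "(i, j) \<in> ?D" "n \<le> i + j" by force
  then show ?thesis
  proof cases
    case degree
    have "homogeneous (card ?D) ?P"
      by (rule homogeneous_prod) (use fin in \<open>auto simp del: One_nat_def intro: homogeneous_var_add\<close>)
    with degree show ?thesis using key_coeff_homogeneous by blast
  next
    case few_vars
    have "swap_vars n ?P = ?P"
      unfolding swap_vars_prod
      by (rule prod.cong) (use few_vars in \<open>auto simp: swap_vars_add swap_vars_var\<close>)
    then show ?thesis using n key_coeff_symmetric by blast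
  next
    case large
    let ?m = "expo \<mu> 1"
    let ?row = "{1} \<times> {1..?m}"
    have row: "?row \<subseteq> ?D" by (auto simp: diagram_def)
    have "card ?row \<le> n" using card_mono[OF fin row] large(1) by simp
    moreover have "n \<le> ?m + 1"
      using strict_first_part[OF \<mu>, of i] large by (auto simp: diagram_def)
    ultimately consider "?m = n" | "n = ?m + 1" by fastforce
    then show ?thesis
    proof cases
      case 1
      then have "?D = ?row"
        using card_subset_eq[OF fin row] large(1) by simp
      then have "?P = (\<Prod>j\<in>{1..n}. var 1 + var (Suc j))"
        using 1 by (simp add: prod.cartesian_product[symmetric])
      also have "\<dots> = row_prod (Suc n)"
        unfolding row_prod_def
        by (rule prod.reindex_bij_witness[of _ "\<lambda>k. k - 1" Suc]) auto
      finally have P: "?P = row_prod (Suc n)" .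
      have "swap_vars n (row_prod (Suc n)) = row_prod (Suc n)"
      proof (cases "n = 1")
        \<comment> \<open>For \<open>n = 1\<close> the exchange also moves \<open>x_1\<close>, but the only factor is \<open>x_1 + x_2\<close>.\<close>
        case True
        then show ?thesis
          using adj_simps(1)[of 1] adj_simps(2)[of 1]
          by (simp add: row_prod_def swap_vars_add swap_vars_var numeral_2_eq_2 add.commute)
      next
        case False
        with n show ?thesis by (intro swap_vars_row_prod) auto
      qed
      then show ?thesis using n key_coeff_symmetric P by simp
    next
      case 2
      have "card ?row \<noteq> card ?D" using 2 large(1) by simp
      then have "?row \<noteq> ?D" using arg_cong[of ?row ?D card] by blast
      with row have "?row \<subset> ?D" by (rule psubsetI)
      from psubset_imp_ex_mem[OF this] obtain p where p: "p \<in> ?D - ?row" ..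
      obtain a b where "p = (a, b)" by (cases p)
      with p have ab: "(a, b) \<in> ?D" "(a, b) \<notin> ?row" by simp_all
      then have "1 \<le> a" "a \<noteq> 1" and \<mu>a: "1 \<le> expo \<mu> a"
        by (auto simp: diagram_def)
      then have a: "2 \<le> a" by simp
      have "expo \<mu> a \<le> expo \<mu> 2"
        using a
      proof (induction a rule: dec_induct)
        case (step k)
        then have "expo \<mu> (Suc k) \<le> expo \<mu> k"
          using part by (simp add: is_partition_def)
        with step show ?case by simp
      qed simp
      with \<mu>a have \<mu>2: "1 \<le> expo \<mu> 2" by simp
      have row': "insert (2, 1) ?row \<subseteq> ?D" using row \<mu>2 by (auto simp: diagram_def)
      have "?D = insert (2, 1) ?row"
        using card_subset_eq[OF fin row'] large(1) 2 by simp
      then have "?P = (var 2 + var 3) * (\<Prod>j\<in>{1..?m}. var 1 + var (Suc j))"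
        by (simp add: prod.cartesian_product[symmetric] numeral_3_eq_3)
      also have "(\<Prod>j\<in>{1..?m}. var 1 + var (Suc j)) = row_prod n"
        unfolding row_prod_def
        by (rule prod.reindex_bij_witness[of _ "\<lambda>k. k - 1" Suc]) (use 2 in auto)
      finally have "?P = row_prod n * (var 2 + var 3)" by (simp add: mult.commute)
      moreover have "3 \<le> n"
        using strict_first_part[OF \<mu>, of 2] \<mu>2 2 by simp
      ultimately show ?thesis using key_coeff_row_prod_mult by simp
    qed
  qed
qed

section \<open>Sorting weak compositions\<close>

lemma down_closed_eq_initial_segment:
  fixes S :: "nat set"
  assumes "finite S" "0 \<notin> S" "\<And>i. 1 \<le> i \<Longrightarrow> Suc i \<in> S \<Longrightarrow> i \<in> S"
  shows "S = {1..card S}"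
proof (cases "S = {}")
  case False
  have down: "k \<in> S" if "1 \<le> k" "k + d \<in> S" for k d
    using that(2)
  proof (induction d)
    case (Suc d)
    then show ?case using assms(3)[of "k + d"] that(1) by simp
  qed simp
  have "S = {1..Max S}"
  proof
    show "S \<subseteq> {1..Max S}"
      using assms by (auto simp: Suc_le_eq intro!: gr0I)
    show "{1..Max S} \<subseteq> S"
    proof
      fix k assume k: "k \<in> {1..Max S}"
      then have "k + (Max S - k) \<in> S" using Max_in[OF assms(1) False] by simp
      with k show "k \<in> S" using down[of k "Max S - k"] by simp
    qed
  qed
  then show ?thesis by (metis card_atLeastAtMost diff_Suc_1)
qed simp

lemma finite_level_set: "1 \<le> j \<Longrightarrow> finite {i. j \<le> expo \<nu> i}"
  by (rule finite_subset[OF _ finite_keys[of \<nu>]]) (auto simp: in_keys_iff)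

text \<open>
  The level sets of a partition are initial segments of the positive integers, hence given by their
  sizes.
\<close>

lemma partition_eqI:
  assumes "is_partition \<nu>" "is_partition \<nu>'"
    and card: "\<And>j. 1 \<le> j \<Longrightarrow> card {i. j \<le> expo \<nu> i} = card {i. j \<le> expo \<nu>' i}"
  shows "\<nu> = \<nu>'"
proof -
  have "{i. j \<le> expo \<nu> i} = {i. j \<le> expo \<nu>' i}" if j: "1 \<le> j" for j
  proof -
    have initial: "{i. j \<le> expo \<nu> i} = {1..card {i. j \<le> expo \<nu> i}}" if "is_partition \<nu>" for \<nu>
      using that j finite_level_set[OF j]
      by (intro down_closed_eq_initial_segment) (auto simp: is_partition_def weak_comp_def intro: order_trans)
    show ?thesis
      using initial[OF assms(1)] initial[OF assms(2)] card[OF j] by simp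
  qed
  then have iff: "j \<le> expo \<nu> i \<longleftrightarrow> j \<le> expo \<nu>' i" for i j
    by (metis (mono_tags, lifting) mem_Collect_eq le0 less_one not_le)
  have "expo \<nu> i = expo \<nu>' i" for i
    using iff[of "expo \<nu> i" i] iff[of "expo \<nu>' i" i] by simp
  then show ?thesis by (rule poly_mapping_eqI)
qed

lemma word_perm_simps [simp]: "word_perm [] = id" "word_perm (i # ws) = adj i \<circ> word_perm ws"
  by (simp_all add: word_perm_def)

lemma word_perm_append: "word_perm (us @ vs) = word_perm us \<circ> word_perm vs"
  by (induction us) (simp_all add: comp_assoc)

lemma adj_comp_adj [simp]: "adj i \<circ> adj i = id"
  by (simp add: fun_eq_iff)

lemma word_perm_rev: "word_perm ws \<circ> word_perm (rev ws) = id"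
proof (induction ws)
  case (Cons i ws)
  have "word_perm (i # ws) \<circ> word_perm (rev (i # ws)) =
      adj i \<circ> (word_perm ws \<circ> word_perm (rev ws)) \<circ> adj i"
    by (simp add: word_perm_append comp_assoc)
  also have "\<dots> = id"
    by (simp only: Cons comp_id adj_comp_adj)
  finally show ?case .
qed simp

lemma word_perm_rev': "word_perm (rev ws) \<circ> word_perm ws = id"
  using word_perm_rev[of "rev ws"] by simp

lemma bij_word_perm: "bij (word_perm ws)"
  using o_bij[OF word_perm_rev' word_perm_rev] .

lemma inv_word_perm: "inv (word_perm ws) = word_perm (rev ws)"
  using inv_unique_comp[OF word_perm_rev word_perm_rev'] .

lemma S_inf_bij: "w \<in> S_inf \<Longrightarrow> bij w"
  by (auto simp: S_inf_def bij_word_perm)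

lemma S_inf_inv: "w \<in> S_inf \<Longrightarrow> inv w \<in> S_inf"
  by (auto simp: S_inf_def inv_word_perm)

lemma S_inf_comp: "v \<in> S_inf \<Longrightarrow> w \<in> S_inf \<Longrightarrow> v \<circ> w \<in> S_inf"
  unfolding S_inf_def by (auto simp: word_perm_append[symmetric] intro!: imageI)

lemma id_in_S_inf: "id \<in> S_inf"
  unfolding S_inf_def by (rule image_eqI[of _ _ "[]"]) auto

lemma adj_in_S_inf: "1 \<le> i \<Longrightarrow> adj i \<in> S_inf"
  unfolding S_inf_def by (rule image_eqI[of _ _ "[i]"]) auto

lemma expo_act: "bij w \<Longrightarrow> expo (act w m) i = expo m (inv w i)"
  by (simp add: act_def lookup_map_key_bij bij_imp_bij_inv bij_is_inj)

lemma act_comp: "bij v \<Longrightarrow> bij w \<Longrightarrow> act v (act w m) = act (v \<circ> w) m"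
  by (rule poly_mapping_eqI) (simp add: expo_act bij_comp o_inv_distrib)

lemma act_inv: "bij w \<Longrightarrow> act (inv w) (act w m) = m"
  by (rule poly_mapping_eqI) (simp add: expo_act bij_imp_bij_inv inv_inv_eq bij_is_inj)

lemma act_id [simp]: "act id m = m"
  by (rule poly_mapping_eqI) (simp add: expo_act)

lemma act_adj: "act (adj i) = swap_expo i"
  using inv_unique_comp[OF adj_comp_adj adj_comp_adj, of i] by (intro ext) (simp only: act_def)

lemma card_level_act:
  assumes "bij w" shows "card {i. j \<le> expo (act w m) i} = card {i. j \<le> expo m i}"
proof -
  have "{i. j \<le> expo (act w m) i} = inv w -` {i. j \<le> expo m i}"
    using assms by (auto simp: expo_act)
  moreover have "inj (inv w)" "{i. j \<le> expo m i} \<subseteq> range (inv w)"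
    using assms by (simp_all add: bij_imp_bij_inv bij_is_inj bij_is_surj)
  ultimately show ?thesis by (simp only: card_vimage_inj)
qed

text \<open>
  The sizes of the level sets are invariant under permutation, so no other partition can arise from
  the same weak composition.
\<close>

lemma sort_comp_eqI:
  assumes "is_partition (act w \<alpha>)" "w \<in> S_inf"
  shows "sort_comp \<alpha> = act w \<alpha>"
  unfolding sort_comp_def
proof (rule the_equality)
  fix \<nu> assume "is_partition \<nu> \<and> (\<exists>w \<in> S_inf. \<nu> = act w \<alpha>)"
  then show "\<nu> = act w \<alpha>"
    using assms by (intro partition_eqI) (auto simp: card_level_act S_inf_bij)
qed (use assms in blast)

text \<open>
  Bubble sort: exchanging an ascent \<open>\<alpha>_i < \<alpha>_(i+1)\<close> decreases \<open>\<Sum>k. k \<alpha>_k\<close>.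
\<close>

lemma ex_sorting:
  assumes "weak_comp \<alpha>"
  shows "\<exists>w \<in> S_inf. is_partition (act w \<alpha>)"
  using assms
proof (induction "\<Sum>k\<in>Poly_Mapping.keys \<alpha>. k * expo \<alpha> k" arbitrary: \<alpha> rule: less_induct)
  case less
  show ?case
  proof (cases "is_partition \<alpha>")
    case True
    then show ?thesis using id_in_S_inf by (intro bexI[of _ id]) auto
  next
    case False
    with less.prems obtain i where i: "1 \<le> i" "expo \<alpha> i < expo \<alpha> (Suc i)"
      by (auto simp: is_partition_def not_le)
    let ?\<beta> = "act (adj i) \<alpha>"
    have \<beta>: "expo ?\<beta> k = expo \<alpha> (adj i k)" for k
      by (simp add: act_adj lookup_map_key_bij)
    define B where "B = Poly_Mapping.keys \<alpha> - {i, Suc i}"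
    have wt: "(\<Sum>k\<in>Poly_Mapping.keys \<gamma>. k * expo \<gamma> k) =
        i * expo \<gamma> i + (Suc i * expo \<gamma> (Suc i) + (\<Sum>k\<in>B. k * expo \<gamma> k))"
      if "Poly_Mapping.keys \<gamma> \<subseteq> insert i (insert (Suc i) B)" for \<gamma>
    proof -
      have "(\<Sum>k\<in>Poly_Mapping.keys \<gamma>. k * expo \<gamma> k) = (\<Sum>k\<in>insert i (insert (Suc i) B). k * expo \<gamma> k)"
        using that by (intro sum.mono_neutral_left) (auto simp: B_def in_keys_iff)
      then show ?thesis by (simp add: B_def)
    qed
    have "(\<Sum>k\<in>B. k * expo ?\<beta> k) = (\<Sum>k\<in>B. k * expo \<alpha> k)"
      by (intro sum.cong) (auto simp: \<beta> B_def)
    moreover have "Poly_Mapping.keys \<alpha> \<subseteq> insert i (insert (Suc i) B)"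
      by (auto simp: B_def)
    moreover have "Poly_Mapping.keys ?\<beta> \<subseteq> insert i (insert (Suc i) B)"
    proof
      fix k assume "k \<in> Poly_Mapping.keys ?\<beta>"
      then show "k \<in> insert i (insert (Suc i) B)"
        by (cases "k = i \<or> k = Suc i") (auto simp: in_keys_iff \<beta> B_def)
    qed
    ultimately have "(\<Sum>k\<in>Poly_Mapping.keys ?\<beta>. k * expo ?\<beta> k) < (\<Sum>k\<in>Poly_Mapping.keys \<alpha>. k * expo \<alpha> k)"
      using i(2) wt[of \<alpha>] wt[of ?\<beta>] by (simp add: \<beta>)
    moreover have "weak_comp ?\<beta>"
      using less.prems i(1) by (simp add: weak_comp_def \<beta>)
    ultimately obtain w where w: "w \<in> S_inf" "is_partition (act w ?\<beta>)"
      using less.hyps by blast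
    then have "is_partition (act (w \<circ> adj i) \<alpha>)"
      using i(1) by (simp add: act_comp S_inf_bij adj_in_S_inf)
    with w i(1) show ?thesis
      using S_inf_comp adj_in_S_inf by blast
  qed
qed

lemma min_perm_in_S_inf:
  assumes "weak_comp \<alpha>"
  shows "min_perm \<alpha> \<in> S_inf"
proof -
  obtain w where w: "w \<in> S_inf" "is_partition (act w \<alpha>)"
    using ex_sorting[OF assms] by blast
  then have "inv w \<in> S_inf \<and> \<alpha> = act (inv w) (sort_comp \<alpha>)"
    by (simp add: sort_comp_eqI S_inf_inv act_inv S_inf_bij)
  from arg_min_natI[of "\<lambda>u. u \<in> S_inf \<and> \<alpha> = act u (sort_comp \<alpha>)", OF this]
  show ?thesis by (simp add: min_perm_def)
qed

lemma ex_reduced_word: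
  assumes "w \<in> S_inf" shows "\<exists>ws. reduced_word w ws"
proof -
  let ?P = "\<lambda>l. \<exists>ws \<in> lists {1..}. word_perm ws = w \<and> length ws = l"
  from assms have "\<exists>l. ?P l" by (auto simp: S_inf_def)
  then have "?P (LEAST l. ?P l)" by (rule LeastI_ex)
  then show ?thesis by (auto simp: reduced_word_def perm_length_def)
qed

lemma demazure_perm_word:
  assumes "w \<in> S_inf"
  obtains ws where "reduced_word w ws" "\<And>f. demazure_perm w f = foldr demazure ws f"
  using someI_ex[OF ex_reduced_word[OF assms]] by (auto simp: demazure_perm_def)

lemma sort_comp_partition: "is_partition \<nu> \<Longrightarrow> sort_comp \<nu> = \<nu>"
  using sort_comp_eqI[of id \<nu>] id_in_S_inf by simp

lemma perm_length_id: "perm_length id = 0"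
  unfolding perm_length_def by (rule Least_eq_0) (auto intro: bexI[of _ "[]"])

lemma reduced_word_perm_length_0:
  assumes "reduced_word w ws" "perm_length w = 0" shows "ws = []" "w = id"
  using assms by (auto simp: reduced_word_def)

lemma min_perm_partition:
  assumes "is_partition \<nu>" shows "min_perm \<nu> = id"
proof -
  have w: "id \<in> S_inf \<and> \<nu> = act id (sort_comp \<nu>)"
    using id_in_S_inf by (simp add: sort_comp_partition[OF assms])
  have "perm_length (min_perm \<nu>) \<le> perm_length id"
    unfolding min_perm_def using arg_min_nat_le[of "\<lambda>u. u \<in> S_inf \<and> \<nu> = act u (sort_comp \<nu>)", OF w] .
  moreover have "min_perm \<nu> \<in> S_inf"
    using assms by (intro min_perm_in_S_inf) (simp add: is_partition_def)
  ultimately show ?thesis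
    using ex_reduced_word reduced_word_perm_length_0 perm_length_id by (metis le_zero_eq)
qed

lemma demazure_perm_id: "demazure_perm id f = f"
proof -
  obtain ws where "reduced_word id ws" "demazure_perm id f = foldr demazure ws f"
    using demazure_perm_word[OF id_in_S_inf] by metis
  then show ?thesis using reduced_word_perm_length_0 perm_length_id by fastforce
qed

section \<open>Strict partitions with prescribed parts\<close>

text \<open>
  The parts of a strict partition are distinct, so its level sets have as many elements as the sets
  of parts above the level.
\<close>

lemma strict_eqI:
  assumes "is_strict \<mu>" "is_strict \<mu>'" "Poly_Mapping.range \<mu> = Poly_Mapping.range \<mu>'"
  shows "\<mu> = \<mu>'"
proof (rule partition_eqI)
  have "card {i. j \<le> expo \<nu> i} = card {a \<in> Poly_Mapping.range \<nu>. j \<le> a}"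
    if "1 \<le> j" "is_strict \<nu>" for j \<nu>
  proof (rule bij_betw_same_card)
    have "{i. j \<le> expo \<nu> i} \<subseteq> Poly_Mapping.keys \<nu>"
      using that(1) by (auto simp: in_keys_iff)
    moreover have "expo \<nu> ` {i. j \<le> expo \<nu> i} = {a \<in> Poly_Mapping.range \<nu>. j \<le> a}"
      using that(1) by (auto simp: range.rep_eq)
    ultimately show "bij_betw (expo \<nu>) {i. j \<le> expo \<nu> i} {a \<in> Poly_Mapping.range \<nu>. j \<le> a}"
      using that(2) by (auto simp: bij_betw_def is_strict_def intro: inj_on_subset)
  qed
  with assms show "card {i. j \<le> expo \<mu> i} = card {i. j \<le> expo \<mu>' i}" if "1 \<le> j" for j
    using that by simp
qed (use assms in \<open>simp_all add: is_strict_def\<close>)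

lemma strict_with_parts_eqI:
  "is_strict \<mu> \<Longrightarrow> strict_with_parts (Poly_Mapping.range \<mu>) = \<mu>"
  unfolding strict_with_parts_def by (rule the_equality) (auto intro: strict_eqI)

lemma is_strict_strict_with_parts:
  assumes "finite A" "0 \<notin> A"
  shows "is_strict (strict_with_parts A)"
proof -
  define xs where "xs = rev (sorted_list_of_set A)"
  \<comment> \<open>The leading \<open>0\<close> fills the dummy position, so that the largest part is at position \<open>1\<close>.\<close>
  define \<mu> where "\<mu> = Poly_Mapping.nth (0 # xs)"
  have xs: "set xs = A" "distinct xs" "sorted_wrt (\<ge>) xs"
    using assms by (simp_all add: xs_def sorted_wrt_rev)
  have zero: "expo \<mu> 0 = 0" and Suc: "expo \<mu> (Suc i) = nth_default 0 xs i" for i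
    by (simp_all add: \<mu>_def)
  have range: "Poly_Mapping.range \<mu> = A"
    using assms xs by (auto simp: \<mu>_def)
  have "expo \<mu> (i + 1) \<le> expo \<mu> i" if "1 \<le> i" for i
  proof -
    obtain k where k: "i = Suc k" using \<open>1 \<le> i\<close> by (cases i) auto
    show ?thesis
      using xs(3) by (auto simp: k Suc nth_default_def sorted_wrt_iff_nth_less)
  qed
  then have "is_partition \<mu>"
    using zero by (simp add: is_partition_def weak_comp_def)
  moreover have "inj_on (expo \<mu>) (Poly_Mapping.keys \<mu>)"
  proof (rule inj_onI)
    fix i j assume ij: "i \<in> Poly_Mapping.keys \<mu>" "j \<in> Poly_Mapping.keys \<mu>" "expo \<mu> i = expo \<mu> j"
    then obtain i' j' where "i = Suc i'" "j = Suc j'"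
      using zero by (metis in_keys_iff not0_implies_Suc)
    with ij xs(2) show "i = j"
      by (auto simp: in_keys_iff Suc nth_default_def nth_eq_iff_index_eq split: if_splits)
  qed
  ultimately have "is_strict \<mu>" by (simp add: is_strict_def)
  with strict_with_parts_eqI[OF this] range show ?thesis by simp
qed

lemma is_strict_half_less: "is_strict (half_less \<nu>)"
proof -
  have "{expo \<nu> i - i | i. 1 \<le> i} \<inter> {1..} \<subseteq> (\<lambda>i. expo \<nu> i - i) ` Poly_Mapping.keys \<nu>"
    by (force simp: in_keys_iff)
  then have "finite ({expo \<nu> i - i | i. 1 \<le> i} \<inter> {1..})"
    by (rule finite_subset) simp
  then show ?thesis
    unfolding half_less_def by (intro is_strict_strict_with_parts) auto
qed

section \<open>Comparing the two families\<close>

lemma key_coeff_kappaP: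
  assumes "1 \<le> n" "weak_comp \<alpha>"
  shows "key_coeff n (kappaP \<alpha>) = 0"
proof -
  obtain ws where ws: "reduced_word (min_perm \<alpha>) ws"
    "\<And>f. demazure_perm (min_perm \<alpha>) f = foldr demazure ws f"
    using demazure_perm_word[OF min_perm_in_S_inf[OF assms(2)]] by blast
  then show ?thesis
    unfolding kappaP_def kappaP_perm_def ws(2)
    using assms(1) key_coeff_diagram_prod[OF is_strict_half_less]
    by (intro key_coeff_foldr_demazure) (auto simp: reduced_word_def)
qed

text \<open>
  Every term of \<open>x_1 row_prod n\<close> other than \<open>x_1 \<dots> x_n\<close> is divisible by \<open>x_1^2\<close>;
  the factor \<open>2\<close> comes from \<open>k = 1\<close>.
\<close>

lemma key_coeff_hook_prod:
  assumes "1 \<le> n"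
  shows "key_coeff n (\<Prod>k\<in>{1..n}. var 1 + var k) = 2"
proof -
  obtain R where R: "row_prod n = (\<Prod>k\<in>{2..n}. var k) + var 1 * R"
    unfolding row_prod_def using prod_var_add_expand[of "{2..n}"] by auto
  have ins: "{1..n} = insert 1 {2..n}" using assms by auto
  have "var 1 * (\<Prod>k\<in>{2..n}. var k) = monomial (ones n)"
    unfolding prod_var_eq_monomial_ones[symmetric] ins by simp
  then have half: "var 1 * row_prod n = monomial (ones n) + var 1 * (var 1 * R)"
    by (simp add: R distrib_left)
  have "(\<Prod>k\<in>{1..n}. var 1 + var k) = var 1 * row_prod n + var 1 * row_prod n"
    unfolding ins by (simp add: row_prod_def distrib_right)
  then show ?thesis
    using assms by (simp only: half key_coeff_add key_coeff_ones key_coeff_var_1_1)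
qed

text \<open>
  The partition \<open>(n, 1^(n-1))\<close>: it is its own transpose, and the half of it that includes the
  diagonal is the single row \<open>(n)\<close>.
\<close>

definition hook :: "nat \<Rightarrow> (nat \<Rightarrow>\<^sub>0 nat)"
  where "hook n = Poly_Mapping.single 1 (n - 1) + ones n"

lemma expo_hook: "1 \<le> n \<Longrightarrow> expo (hook n) i = (if i = 1 then n else if 2 \<le> i \<and> i \<le> n then 1 else 0)"
  by (auto simp: hook_def lookup_add lookup_single expo_ones when_def)

lemma is_partition_hook: "1 \<le> n \<Longrightarrow> is_partition (hook n)"
  by (auto simp: is_partition_def weak_comp_def expo_hook)

lemma symmetric_comp_hook:
  assumes "1 \<le> n" shows "symmetric_comp (hook n)"
proof -
  have "conjugate (hook n) = hook n"
  proof (rule poly_mapping_eqI)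
    fix j
    have "{i. 1 \<le> i \<and> j \<le> expo (hook n) i} = (if j = 1 then {1..n} else if j \<le> n then {1} else {})"
      if "j \<noteq> 0"
      using assms that by (auto simp: expo_hook split: if_splits)
    then have "expo (conjugate (hook n)) j =
        (if j = 0 then 0 else card (if j = 1 then {1..n} else if j \<le> n then {1} else {}))"
      by (cases "j = 0") (simp_all only: conjugate.rep_eq if_True if_False simp_thms)
    then show "expo (conjugate (hook n)) j = expo (hook n) j"
      using assms by (auto simp: expo_hook)
  qed
  with is_partition_hook[OF assms] show ?thesis
    by (simp add: symmetric_comp_def symmetric_partition_def sort_comp_partition is_partition_def)
qed

lemma half_le_hook:
  assumes "1 \<le> n" shows "half_le (hook n) = Poly_Mapping.single 1 n"
proof -
  have "{expo (hook n) i - (i - 1) | i. 1 \<le> i} \<inter> {1..} = {n}"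
  proof
    show "{expo (hook n) i - (i - 1) | i. 1 \<le> i} \<inter> {1..} \<subseteq> {n}"
      using assms by (auto simp: expo_hook split: if_splits)
    have "n = expo (hook n) 1 - (1 - 1)" using assms by (simp add: expo_hook)
    then show "{n} \<subseteq> {expo (hook n) i - (i - 1) | i. 1 \<le> i} \<inter> {1..}"
      using assms by blast
  qed
  moreover have "is_strict (Poly_Mapping.single 1 n)"
    by (auto simp: is_strict_def is_partition_def weak_comp_def lookup_single when_def)
  from strict_with_parts_eqI[OF this] have "strict_with_parts {n} = Poly_Mapping.single 1 n"
    using assms by simp
  ultimately show ?thesis by (simp add: half_le_def)
qed

lemma kappaQ_hook:
  assumes "1 \<le> n" shows "kappaQ (hook n) = (\<Prod>k\<in>{1..n}. var 1 + var k)"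
proof -
  have "diagram (Poly_Mapping.single 1 n) = {1} \<times> {1..n}"
    by (auto simp: diagram_def lookup_single when_def split: if_splits)
  then show ?thesis
    using is_partition_hook[OF assms] assms
    by (simp add: kappaQ_def kappaQ_perm_def min_perm_partition sort_comp_partition half_le_hook
      demazure_perm_id prod.cartesian_product[symmetric])
qed

theorem corollary2p58:
  fixes n :: nat
  assumes "n \<ge> 1"
  shows "\<not> rat_span {kappaQ \<alpha> | \<alpha>. symmetric_comp \<alpha> \<and> total_degree (kappaQ \<alpha>) = n}
    \<subseteq> rat_span {kappaP \<alpha> | \<alpha>. symmetric_comp \<alpha> \<and> total_degree (kappaP \<alpha>) = n}"
proof
  interpret module poly_scale by (rule module_poly_scale)
  let ?Q = "kappaQ (hook n)"
  assume sub: "rat_span {kappaQ \<alpha> | \<alpha>. symmetric_comp \<alpha> \<and> total_degree (kappaQ \<alpha>) = n}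
    \<subseteq> rat_span {kappaP \<alpha> | \<alpha>. symmetric_comp \<alpha> \<and> total_degree (kappaP \<alpha>) = n}"
  have coeffQ: "key_coeff n ?Q = 2"
    using assms by (simp only: kappaQ_hook key_coeff_hook_prod)
  have zero: "key_coeff n 0 = 0"
    using key_coeff_diff[of n 0 0] by simp
  have "homogeneous (card {1..n}) ?Q"
    unfolding kappaQ_hook[OF assms]
    by (rule homogeneous_prod) (auto simp del: One_nat_def intro: homogeneous_var_add)
  then have "total_degree ?Q = n"
    using coeffQ zero by (intro total_degree_homogeneous) auto
  then have "?Q \<in> {kappaQ \<alpha> | \<alpha>. symmetric_comp \<alpha> \<and> total_degree (kappaQ \<alpha>) = n}"
    using symmetric_comp_hook[OF assms] by blast
  then have "?Q \<in> rat_span {kappaQ \<alpha> | \<alpha>. symmetric_comp \<alpha> \<and> total_degree (kappaQ \<alpha>) = n}"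
    unfolding rat_span_def by (rule span_base)
  then have "?Q \<in> rat_span {kappaP \<alpha> | \<alpha>. symmetric_comp \<alpha> \<and> total_degree (kappaP \<alpha>) = n}"
    using sub by (rule subsetD[rotated])
  also have "\<dots> \<subseteq> {f. key_coeff n f = 0}"
    unfolding rat_span_def
  proof (rule span_minimal)
    show "subspace {f. key_coeff n f = 0}"
      by (simp add: subspace_def key_coeff_add key_coeff_scale zero)
    show "{kappaP \<alpha> | \<alpha>. symmetric_comp \<alpha> \<and> total_degree (kappaP \<alpha>) = n} \<subseteq> {f. key_coeff n f = 0}"
      using key_coeff_kappaP[OF assms] by (auto simp: symmetric_comp_def)
  qed
  finally show False using coeffQ by simp
qed

end
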